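(* Let $M=[S;A_M;P_M;B_M]$ be a mathematical system with underlying recursive system $S=[A_S;P_S;B_S]$ such that $A_M=A_S$, $P_M=P_S$, $B_M=B_S$. Suppose that $[M;\mathcal L]$ is a mathematical system with restricted argument lists in $\mathcal L$, that $\mathcal L$ is enumerable, and that the set $\mathcal L_*$ of all $A_S$-lists in $\mathcal L$ without variables is nonempty. Then: (i) for all $\lambda,\mu\in\mathcal L_*$: $\sim\lambda,\mu\in\Pi(M;\mathcal L)$ if and only if $\sim\lambda,\mu\in\Pi_R(S;\mathcal L)$; (ii) for all $p\in P_S$, $i\ge0$ and $\lambda_1,\dots,\lambda_i\in\mathcal L_*$: $p\,\lambda_1,\dots,\lambda_i\in\Pi(M;\mathcal L)$ if and only if $p\,\lambda_1,\dots,\lambda_i\in\Pi_R(S;\mathcal L)$.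
   Context: Framework. $X$ is a countably infinite set of variables. Formulas are written in Polish (prefix) notation. A recursive system $S=[A_S;P_S;B_S]$ consists of a finite alphabet $A_S$ of constant symbols, a finite list $P_S$ of predicate symbols (the same symbol may be used with several arities) and a finite list $B_S$ of basis R-axioms. Lists (argument terms) are strings built from constant symbols and variables. A prime R-formula is $p\,\lambda_1,\dots,\lambda_i$ ($p\in P_S$, $i\ge0$; $p$ "occurs $i$-ary") or an equation $\sim\lambda,\mu$. An R-formula is a prime R-formula or $\to F\,G$ with $F$ a prime R-formula and $G$ an R-formula; its last prime formula is its R-conclusion. R-axioms are the basis R-axioms and the R-axioms of equality (reflexivity $\sim x,x$ and substitutivity of equals in equations and in each predicate symbol of each arity). An R-derivation in $[S;\mathcal L]$ is a finite list of R-formulas, all argument lists in $\mathcal L$, each obtained by: (a) writing an R-axiom; (b) from a prime R-formula $F$ and $\to F\,G$ inferring $G$; (c) from $F$ inferring $F\frac{\lambda}{x}$ (replace every occurrence of variable $x$ by $\lambda$) with $\lambda\in\mathcal L$. $\Pi_R(S;\mathcal L)$ is the set of R-formulas R-derivable in $[S;\mathcal L]$. A mathematical system $M=[S;A_M;P_M;B_M]$ with restricted argument lists $\mathcal L$, written $[M;\mathcal L]$, has $A_M\supseteq A_S$, $P_M\supseteq P_S$, a set $\mathcal L$ of lists containing every variable and closed under substituting lists of $\mathcal L$ for variables, and basis axioms $B_M\supseteq B_S$. Formulas: prime formulas with arguments in $\mathcal L$, and $\neg F$, $J\,F\,G$ ($J\in\{\to,\leftrightarrow,\&,\vee\}$),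 $\forall x\,F$, $\exists x\,F$. $F\frac{\lambda}{x}$ replaces free occurrences of $x$ by $\lambda$; $\mathrm{CF}(F;\lambda;x)$ means this substitution is collision-free. Axioms: basis axioms; instances of identically true propositional functions; axioms of equality (the R-axioms of equality); quantifier axioms $\to\forall x F\;F$, $\to\forall x\to F\,G\;\to F\,\forall x\,G$ (if $x\notin\mathrm{free}(F)$), $\leftrightarrow\neg\forall x\neg F\;\exists x F$. Rules: (a) write an axiom; (b) from $F$ and $\to F\,G$ infer $G$; (c) from $F$ infer $F\frac{\lambda}{x}$ if $\lambda\in\mathcal L$ and $\mathrm{CF}(F;\lambda;x)$; (d) from $F$ infer $\forall x F$; (e) induction: for $p\in P_S$, distinct variables $x_1,\dots,x_i$ and a formula $G$ such that $x_1,\dots,x_i$ and the variables of $G$ do not occur in $B_S$, let $F'$ ($F\in B_S$) be obtained by replacing every $i$-ary subformula $p\,\lambda_1,\dots,\lambda_i$ by $G\frac{\lambda_1}{x_1}\cdots\frac{\lambda_i}{x_i}$; if $F'$ already occurs in the proof for every $F\in B_S$ whose R-conclusion has $p$ occurring $i$-ary, one may write $\to p\,x_1,\dots,x_i\;G$. A proof is a finite list of formulas each obtained by a rule from earlier ones; $\Pi(M;\mathcal L)$ is the set of provable formulas. *)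

theory Defs
  imports Main
begin

section \<open>Lists and formulas\<close>

text \<open>
  The countably infinite set \<open>X\<close> of variables is represented by \<open>nat\<close>. Formulas are represented by
  their parse trees instead of by strings in Polish notation. A predicate symbol may be used with
  several arities, so the arity of an occurrence is the length of its argument list.
\<close>

datatype 'a sym = Const 'a | Var nat

type_synonym 'a lst = "'a sym list"

datatype ('a, 'p) fm =
    Eq "'a lst" "'a lst"
  | Pred 'p "'a lst list"
  | Neg "('a, 'p) fm"
  | Imp "('a, 'p) fm" "('a, 'p) fm"
  | Iff "('a, 'p) fm" "('a, 'p) fm"
  | Conj "('a, 'p) fm" "('a, 'p) fm"
  | Disj "('a, 'p) fm" "('a, 'p) fm"
  | Forall nat "('a, 'p) fm"
  | Exists nat "('a, 'p) fm"

definition lists_over :: "'a set \<Rightarrow> 'a lst set" where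
  "lists_over A = {l. \<forall>a. Const a \<in> set l \<longrightarrow> a \<in> A}"

definition vars_lst :: "'a lst \<Rightarrow> nat set" where
  "vars_lst l = {x. Var x \<in> set l}"

definition subst_lst :: "'a lst \<Rightarrow> 'a lst \<Rightarrow> nat \<Rightarrow> 'a lst" where
  "subst_lst l m x = concat (map (\<lambda>s. if s = Var x then m else [s]) l)"

primrec free :: "('a, 'p) fm \<Rightarrow> nat set" where
  "free (Eq l m) = vars_lst l \<union> vars_lst m"
| "free (Pred p ls) = (\<Union>l\<in>set ls. vars_lst l)"
| "free (Neg F) = free F"
| "free (Imp F G) = free F \<union> free G"
| "free (Iff F G) = free F \<union> free G"
| "free (Conj F G) = free F \<union> free G"
| "free (Disj F G) = free F \<union> free G"
| "free (Forall x F) = free F - {x}"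
| "free (Exists x F) = free F - {x}"

text \<open>All variables occurring in a formula, including bound ones and those next to a quantifier.\<close>

primrec vars :: "('a, 'p) fm \<Rightarrow> nat set" where
  "vars (Eq l m) = vars_lst l \<union> vars_lst m"
| "vars (Pred p ls) = (\<Union>l\<in>set ls. vars_lst l)"
| "vars (Neg F) = vars F"
| "vars (Imp F G) = vars F \<union> vars G"
| "vars (Iff F G) = vars F \<union> vars G"
| "vars (Conj F G) = vars F \<union> vars G"
| "vars (Disj F G) = vars F \<union> vars G"
| "vars (Forall x F) = insert x (vars F)"
| "vars (Exists x F) = insert x (vars F)"

text \<open>
  \<open>subst F m x\<close> replaces the free occurrences of \<open>x\<close> by \<open>m\<close>, without renaming bound variables.
  On R-formulas, which have no quantifiers, it replaces every occurrence.
\<close>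

primrec subst :: "('a, 'p) fm \<Rightarrow> 'a lst \<Rightarrow> nat \<Rightarrow> ('a, 'p) fm" where
  "subst (Eq k l) m x = Eq (subst_lst k m x) (subst_lst l m x)"
| "subst (Pred p ls) m x = Pred p (map (\<lambda>l. subst_lst l m x) ls)"
| "subst (Neg F) m x = Neg (subst F m x)"
| "subst (Imp F G) m x = Imp (subst F m x) (subst G m x)"
| "subst (Iff F G) m x = Iff (subst F m x) (subst G m x)"
| "subst (Conj F G) m x = Conj (subst F m x) (subst G m x)"
| "subst (Disj F G) m x = Disj (subst F m x) (subst G m x)"
| "subst (Forall y F) m x = (if y = x then Forall y F else Forall y (subst F m x))"
| "subst (Exists y F) m x = (if y = x then Exists y F else Exists y (subst F m x))"

text \<open>Collision-free substitution \<open>CF(F; m; x)\<close>: no variable of \<open>m\<close> gets bound in \<open>subst F m x\<close>.\<close>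

primrec CF :: "('a, 'p) fm \<Rightarrow> 'a lst \<Rightarrow> nat \<Rightarrow> bool" where
  "CF (Eq k l) m x = True"
| "CF (Pred p ls) m x = True"
| "CF (Neg F) m x = CF F m x"
| "CF (Imp F G) m x = (CF F m x \<and> CF G m x)"
| "CF (Iff F G) m x = (CF F m x \<and> CF G m x)"
| "CF (Conj F G) m x = (CF F m x \<and> CF G m x)"
| "CF (Disj F G) m x = (CF F m x \<and> CF G m x)"
| "CF (Forall y F) m x = (x \<notin> free (Forall y F) \<or> (y \<notin> vars_lst m \<and> CF F m x))"
| "CF (Exists y F) m x = (x \<notin> free (Exists y F) \<or> (y \<notin> vars_lst m \<and> CF F m x))"

text \<open>Formulas with predicate symbols in \<open>P\<close> and argument lists in \<open>L\<close>.\<close>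

primrec is_formula :: "'p set \<Rightarrow> 'a lst set \<Rightarrow> ('a, 'p) fm \<Rightarrow> bool" where
  "is_formula P L (Eq l m) = (l \<in> L \<and> m \<in> L)"
| "is_formula P L (Pred p ls) = (p \<in> P \<and> set ls \<subseteq> L)"
| "is_formula P L (Neg F) = is_formula P L F"
| "is_formula P L (Imp F G) = (is_formula P L F \<and> is_formula P L G)"
| "is_formula P L (Iff F G) = (is_formula P L F \<and> is_formula P L G)"
| "is_formula P L (Conj F G) = (is_formula P L F \<and> is_formula P L G)"
| "is_formula P L (Disj F G) = (is_formula P L F \<and> is_formula P L G)"
| "is_formula P L (Forall x F) = is_formula P L F"
| "is_formula P L (Exists x F) = is_formula P L F"

fun is_prime :: "('a, 'p) fm \<Rightarrow> bool" where
  "is_prime (Eq l m) = True"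
| "is_prime (Pred p ls) = True"
| "is_prime _ = False"

fun is_rformula :: "('a, 'p) fm \<Rightarrow> bool" where
  "is_rformula (Imp F G) = (is_prime F \<and> is_rformula G)"
| "is_rformula F = is_prime F"

fun rconclusion :: "('a, 'p) fm \<Rightarrow> ('a, 'p) fm" where
  "rconclusion (Imp F G) = rconclusion G"
| "rconclusion F = F"

text \<open>
  Substitutivity of equals: if \<open>x\<close> equals \<open>y\<close>, then \<open>x\<close> may be replaced by \<open>y\<close> in an equation or in a
  predicate formula \<open>F\<close> of any arity. The arguments of \<open>F\<close> are arbitrary lists, not just variables,
  since there are no function symbols for which congruence axioms could be stated separately. The
  restriction to predicate symbols and argument lists of the system is imposed on the lines of a
  derivation.
\<close>

definition equality_axioms :: "('a, 'p) fm set" where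
  "equality_axioms =
     {Eq [Var x] [Var x] | x. True} \<union>
     {Imp (Eq [Var x] [Var y]) (Imp F (subst F [Var y] x)) | x y F. is_prime F}"


section \<open>Recursive systems\<close>

record ('a, 'p) rec_sys =
  r_alph :: "'a set"
  r_preds :: "'p set"
  r_basis :: "('a, 'p) fm set"

definition recursive_system :: "('a, 'p) rec_sys \<Rightarrow> bool" where
  "recursive_system S \<longleftrightarrow>
     finite (r_alph S) \<and> finite (r_preds S) \<and> finite (r_basis S) \<and>
     (\<forall>F\<in>r_basis S. is_rformula F \<and> is_formula (r_preds S) (lists_over (r_alph S)) F)"

text \<open>\<open>r_step S L \<Gamma> F\<close>: the formula \<open>F\<close> is obtained by one of the rules from the formulas in \<open>\<Gamma>\<close>.\<close>

inductive r_step ::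
  "('a, 'p) rec_sys \<Rightarrow> 'a lst set \<Rightarrow> ('a, 'p) fm set \<Rightarrow> ('a, 'p) fm \<Rightarrow> bool"
  for S :: "('a, 'p) rec_sys" and L :: "'a lst set" and \<Gamma> :: "('a, 'p) fm set" where
  r_axiom: "F \<in> r_basis S \<union> equality_axioms \<Longrightarrow> r_step S L \<Gamma> F"
| r_mp: "is_prime F \<Longrightarrow> F \<in> \<Gamma> \<Longrightarrow> Imp F G \<in> \<Gamma> \<Longrightarrow> r_step S L \<Gamma> G"
| r_subst: "F \<in> \<Gamma> \<Longrightarrow> m \<in> L \<Longrightarrow> r_step S L \<Gamma> (subst F m x)"

definition r_derivation :: "('a, 'p) rec_sys \<Rightarrow> 'a lst set \<Rightarrow> ('a, 'p) fm list \<Rightarrow> bool" where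
  "r_derivation S L Fs \<longleftrightarrow>
     (\<forall>k<length Fs. is_rformula (Fs ! k) \<and> is_formula (r_preds S) L (Fs ! k) \<and>
                    r_step S L (set (take k Fs)) (Fs ! k))"

definition Pi_R :: "('a, 'p) rec_sys \<Rightarrow> 'a lst set \<Rightarrow> ('a, 'p) fm set" where
  "Pi_R S L = {F. \<exists>Fs. r_derivation S L Fs \<and> F \<in> set Fs}"


section \<open>Enumerable sets of lists\<close>

text \<open>
  A set of variable-free lists is (recursively) enumerable if it is represented by a predicate symbol
  of some recursive system. As the lists in \<open>L\<close> together may contain infinitely many variables,
  the variable number \<open>n\<close> is first written as \<open>v'...'\<close> with \<open>n\<close> primes over two new constant symbols
  \<open>v = Inr 0\<close> and \<open>' = Inr 1\<close>; the remaining symbols \<open>Inr k\<close> are available as auxiliary symbols.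
\<close>

primrec code_sym :: "'a sym \<Rightarrow> ('a + nat) lst" where
  "code_sym (Const a) = [Const (Inl a)]"
| "code_sym (Var n) = Const (Inr 0) # replicate n (Const (Inr 1))"

definition code_lst :: "'a lst \<Rightarrow> ('a + nat) lst" where
  "code_lst l = concat (map code_sym l)"

definition enumerable :: "'a lst set \<Rightarrow> bool" where
  "enumerable L \<longleftrightarrow>
     (\<exists>(T :: ('a + nat, nat) rec_sys) p.
        recursive_system T \<and> p \<in> r_preds T \<and>
        code_lst ` L = {w. vars_lst w = {} \<and> Pred p [w] \<in> Pi_R T (lists_over (r_alph T))})"


section \<open>Mathematical systems with restricted argument lists\<close>

record ('a, 'p) math_sys =
  m_rec :: "('a, 'p) rec_sys"
  m_alph :: "'a set"
  m_preds :: "'p set"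
  m_basis :: "('a, 'p) fm set"

definition restricted_lists :: "'a set \<Rightarrow> 'a lst set \<Rightarrow> bool" where
  "restricted_lists A L \<longleftrightarrow>
     L \<subseteq> lists_over A \<and> (\<forall>x. [Var x] \<in> L) \<and> (\<forall>l\<in>L. \<forall>m\<in>L. \<forall>x. subst_lst l m x \<in> L)"

definition mathematical_system :: "('a, 'p) math_sys \<Rightarrow> 'a lst set \<Rightarrow> bool" where
  "mathematical_system M L \<longleftrightarrow>
     recursive_system (m_rec M) \<and>
     r_alph (m_rec M) \<subseteq> m_alph M \<and>
     r_preds (m_rec M) \<subseteq> m_preds M \<and>
     r_basis (m_rec M) \<subseteq> m_basis M \<and>
     (\<forall>F\<in>m_basis M. is_formula (m_preds M) (lists_over (m_alph M)) F) \<and>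
     restricted_lists (m_alph M) L"

datatype propf =
    PVar nat
  | PNeg propf
  | PImp propf propf
  | PIff propf propf
  | PConj propf propf
  | PDisj propf propf

primrec prop_val :: "(nat \<Rightarrow> bool) \<Rightarrow> propf \<Rightarrow> bool" where
  "prop_val v (PVar n) = v n"
| "prop_val v (PNeg a) = (\<not> prop_val v a)"
| "prop_val v (PImp a b) = (prop_val v a \<longrightarrow> prop_val v b)"
| "prop_val v (PIff a b) = (prop_val v a \<longleftrightarrow> prop_val v b)"
| "prop_val v (PConj a b) = (prop_val v a \<and> prop_val v b)"
| "prop_val v (PDisj a b) = (prop_val v a \<or> prop_val v b)"

primrec prop_inst :: "(nat \<Rightarrow> ('a, 'p) fm) \<Rightarrow> propf \<Rightarrow> ('a, 'p) fm" where
  "prop_inst s (PVar n) = s n"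
| "prop_inst s (PNeg a) = Neg (prop_inst s a)"
| "prop_inst s (PImp a b) = Imp (prop_inst s a) (prop_inst s b)"
| "prop_inst s (PIff a b) = Iff (prop_inst s a) (prop_inst s b)"
| "prop_inst s (PConj a b) = Conj (prop_inst s a) (prop_inst s b)"
| "prop_inst s (PDisj a b) = Disj (prop_inst s a) (prop_inst s b)"

definition prop_axioms :: "('a, 'p) fm set" where
  "prop_axioms = {prop_inst s a | s a. \<forall>v. prop_val v a}"

definition quantifier_axioms :: "('a, 'p) fm set" where
  "quantifier_axioms =
     {Imp (Forall x F) F | x F. True} \<union>
     {Imp (Forall x (Imp F G)) (Imp F (Forall x G)) | x F G. x \<notin> free F} \<union>
     {Iff (Neg (Forall x (Neg F))) (Exists x F) | x F. True}"

text \<open>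
  \<open>replace_pred p xs G F\<close> replaces every subformula \<open>p l\<^sub>1, ..., l\<^sub>i\<close> of \<open>F\<close>, where \<open>i = length xs\<close>, by \<open>G\<close>
  with \<open>l\<^sub>1\<close> substituted for \<open>x\<^sub>1\<close>, then \<open>l\<^sub>2\<close> for \<open>x\<^sub>2\<close>, and so on.
\<close>

primrec replace_pred ::
  "'p \<Rightarrow> nat list \<Rightarrow> ('a, 'p) fm \<Rightarrow> ('a, 'p) fm \<Rightarrow> ('a, 'p) fm" where
  "replace_pred p xs G (Eq l m) = Eq l m"
| "replace_pred p xs G (Pred q ls) =
     (if q = p \<and> length ls = length xs
      then fold (\<lambda>(x, l) H. subst H l x) (zip xs ls) G else Pred q ls)"
| "replace_pred p xs G (Neg E) = Neg (replace_pred p xs G E)"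
| "replace_pred p xs G (Imp E F) = Imp (replace_pred p xs G E) (replace_pred p xs G F)"
| "replace_pred p xs G (Iff E F) = Iff (replace_pred p xs G E) (replace_pred p xs G F)"
| "replace_pred p xs G (Conj E F) = Conj (replace_pred p xs G E) (replace_pred p xs G F)"
| "replace_pred p xs G (Disj E F) = Disj (replace_pred p xs G E) (replace_pred p xs G F)"
| "replace_pred p xs G (Forall x F) = Forall x (replace_pred p xs G F)"
| "replace_pred p xs G (Exists x F) = Exists x (replace_pred p xs G F)"

inductive m_step ::
  "('a, 'p) math_sys \<Rightarrow> 'a lst set \<Rightarrow> ('a, 'p) fm set \<Rightarrow> ('a, 'p) fm \<Rightarrow> bool"
  for M :: "('a, 'p) math_sys" and L :: "'a lst set" and \<Gamma> :: "('a, 'p) fm set" where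
  m_axiom: "F \<in> m_basis M \<union> prop_axioms \<union> equality_axioms \<union> quantifier_axioms \<Longrightarrow>
     m_step M L \<Gamma> F"
| m_mp: "F \<in> \<Gamma> \<Longrightarrow> Imp F G \<in> \<Gamma> \<Longrightarrow> m_step M L \<Gamma> G"
| m_subst: "F \<in> \<Gamma> \<Longrightarrow> m \<in> L \<Longrightarrow> CF F m x \<Longrightarrow> m_step M L \<Gamma> (subst F m x)"
| m_gen: "F \<in> \<Gamma> \<Longrightarrow> m_step M L \<Gamma> (Forall x F)"
| m_induct:
   "p \<in> r_preds (m_rec M) \<Longrightarrow>
    distinct xs \<Longrightarrow>
    is_formula (m_preds M) L G \<Longrightarrow>
    (\<forall>F\<in>r_basis (m_rec M). (set xs \<union> vars G) \<inter> vars F = {}) \<Longrightarrow>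
    (\<forall>F\<in>r_basis (m_rec M).
       (\<exists>ls. length ls = length xs \<and> rconclusion F = Pred p ls) \<longrightarrow> replace_pred p xs G F \<in> \<Gamma>) \<Longrightarrow>
    m_step M L \<Gamma> (Imp (Pred p (map (\<lambda>x. [Var x]) xs)) G)"

definition m_proof :: "('a, 'p) math_sys \<Rightarrow> 'a lst set \<Rightarrow> ('a, 'p) fm list \<Rightarrow> bool" where
  "m_proof M L Fs \<longleftrightarrow>
     (\<forall>k<length Fs. is_formula (m_preds M) L (Fs ! k) \<and>
                    m_step M L (set (take k Fs)) (Fs ! k))"

definition Pi_M :: "('a, 'p) math_sys \<Rightarrow> 'a lst set \<Rightarrow> ('a, 'p) fm set" where
  "Pi_M M L = {F. \<exists>Fs. m_proof M L Fs \<and> F \<in> set Fs}"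

definition ground_lists :: "'a lst set \<Rightarrow> 'a lst set" where
  "ground_lists L = {l \<in> L. vars_lst l = {}}"

end

theory Submission
  imports Defs
begin

text \<open>
  Every R-derivation is a proof. Conversely, the variable-free lists in \<open>L\<close> form a structure in which
  a ground prime formula holds iff it is R-derivable, and every provable formula is valid in it. The
  only delicate rule is induction. For parameters \<open>\<sigma>\<close>, restrict the interpretation of the \<open>i\<close>-ary \<open>p\<close>
  to those arguments that satisfy \<open>G\<close>. The premises of the induction rule say that the basis axioms
  remain valid in this smaller structure, and the substitutivity axioms remain valid because \<open>G\<close>
  cannot distinguish lists that are R-derivably equal. Hence every R-derivable formula is valid in
  the smaller structure, so that every R-derivable \<open>p \<lambda>\<^sub>1, ..., \<lambda>\<^sub>i\<close> satisfies \<open>G\<close>.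
\<close>

section \<open>Semantics\<close>

definition inst :: "(nat \<Rightarrow> 'a lst) \<Rightarrow> 'a lst \<Rightarrow> 'a lst" where
  "inst \<sigma> l = concat (map (case_sym (\<lambda>a. [Const a]) \<sigma>) l)"

text \<open>The values of variables are themselves lists, so an argument list is evaluated by
  \<open>inst\<close>. The interpretations \<open>E\<close> and \<open>R\<close> are parameters
  because two structures occur: the one given by R-derivability and the smaller one used for the
  induction rule.\<close>

primrec eval ::
  "('a lst \<Rightarrow> 'a lst \<Rightarrow> bool) \<Rightarrow> ('p \<Rightarrow> 'a lst list \<Rightarrow> bool) \<Rightarrow> 'a lst set \<Rightarrow>
   (nat \<Rightarrow> 'a lst) \<Rightarrow> ('a, 'p) fm \<Rightarrow> bool" where
  "eval E R D \<sigma> (Eq l m) = E (inst \<sigma> l) (inst \<sigma> m)"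
| "eval E R D \<sigma> (Pred p ls) = R p (map (inst \<sigma>) ls)"
| "eval E R D \<sigma> (Neg F) = (\<not> eval E R D \<sigma> F)"
| "eval E R D \<sigma> (Imp F G) = (eval E R D \<sigma> F \<longrightarrow> eval E R D \<sigma> G)"
| "eval E R D \<sigma> (Iff F G) = (eval E R D \<sigma> F \<longleftrightarrow> eval E R D \<sigma> G)"
| "eval E R D \<sigma> (Conj F G) = (eval E R D \<sigma> F \<and> eval E R D \<sigma> G)"
| "eval E R D \<sigma> (Disj F G) = (eval E R D \<sigma> F \<or> eval E R D \<sigma> G)"
| "eval E R D \<sigma> (Forall x F) = (\<forall>d\<in>D. eval E R D (\<sigma>(x := d)) F)"
| "eval E R D \<sigma> (Exists x F) = (\<exists>d\<in>D. eval E R D (\<sigma>(x := d)) F)"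

text \<open>Unlike \<open>CF\<close> itself, disjointness from \<open>bound_vars\<close> is stable
  under substitution (\<open>bound_vars_subst\<close>). It thus guarantees collision-freeness
  throughout a chain of substitutions.\<close>

primrec bound_vars :: "('a, 'p) fm \<Rightarrow> nat set" where
  "bound_vars (Eq l m) = {}"
| "bound_vars (Pred p ls) = {}"
| "bound_vars (Neg F) = bound_vars F"
| "bound_vars (Imp F G) = bound_vars F \<union> bound_vars G"
| "bound_vars (Iff F G) = bound_vars F \<union> bound_vars G"
| "bound_vars (Conj F G) = bound_vars F \<union> bound_vars G"
| "bound_vars (Disj F G) = bound_vars F \<union> bound_vars G"
| "bound_vars (Forall x F) = insert x (bound_vars F)"
| "bound_vars (Exists x F) = insert x (bound_vars F)"

section \<open>Variables, substitution and collision-freeness\<close>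

lemma inst_Nil [simp]: "inst \<sigma> [] = []"
  by (simp add: inst_def)

lemma inst_Const [simp]: "inst \<sigma> (Const a # l) = Const a # inst \<sigma> l"
  by (simp add: inst_def)

lemma inst_Var [simp]: "inst \<sigma> (Var x # l) = \<sigma> x @ inst \<sigma> l"
  by (simp add: inst_def)

lemma inst_append [simp]: "inst \<sigma> (l @ m) = inst \<sigma> l @ inst \<sigma> m"
  by (simp add: inst_def)

lemma vars_lst_Nil [simp]: "vars_lst [] = {}"
  by (simp add: vars_lst_def)

lemma vars_lst_Const [simp]: "vars_lst (Const a # l) = vars_lst l"
  by (auto simp: vars_lst_def)

lemma vars_lst_Var [simp]: "vars_lst (Var x # l) = insert x (vars_lst l)"
  by (auto simp: vars_lst_def)

lemma vars_lst_append [simp]: "vars_lst (l @ m) = vars_lst l \<union> vars_lst m"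
  by (auto simp: vars_lst_def)

lemma subst_lst_Nil [simp]: "subst_lst [] m x = []"
  by (simp add: subst_lst_def)

lemma subst_lst_Cons [simp]:
  "subst_lst (s # l) m x = (if s = Var x then m else [s]) @ subst_lst l m x"
  by (simp add: subst_lst_def)

lemma lst_induct [case_names Nil Const Var]:
  assumes "P []" "\<And>a l. P l \<Longrightarrow> P (Const a # l)" "\<And>x l. P l \<Longrightarrow> P (Var x # l)"
  shows "P l"
proof (induction l)
  case (Cons s l)
  then show ?case using assms by (cases s) auto
qed (rule assms)

lemma finite_vars_lst [simp]: "finite (vars_lst l)"
  by (induction l rule: lst_induct) auto

lemma finite_free [simp]: "finite (free F)"
  by (induction F) auto

lemma free_subset_vars: "free F \<subseteq> vars F"
  by (induction F) auto

lemma bound_vars_subset_vars: "bound_vars F \<subseteq> vars F"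
  by (induction F) auto

lemma inst_cong: "(\<And>x. x \<in> vars_lst l \<Longrightarrow> \<sigma> x = \<tau> x) \<Longrightarrow> inst \<sigma> l = inst \<tau> l"
  by (induction l rule: lst_induct) auto

lemma inst_ground [simp]: "vars_lst l = {} \<Longrightarrow> inst \<sigma> l = l"
  by (induction l rule: lst_induct) auto

lemma vars_inst: "vars_lst (inst \<sigma> l) = (\<Union>x\<in>vars_lst l. vars_lst (\<sigma> x))"
  by (induction l rule: lst_induct) auto

lemma inst_subst_lst: "inst \<sigma> (subst_lst l m x) = inst (\<sigma>(x := inst \<sigma> m)) l"
  by (induction l rule: lst_induct) auto

lemma vars_subst_lst:
  "vars_lst (subst_lst l m x) = vars_lst l - {x} \<union> (if x \<in> vars_lst l then vars_lst m else {})"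
  by (induction l rule: lst_induct) auto

lemma subst_lst_absent: "x \<notin> vars_lst l \<Longrightarrow> subst_lst l m x = l"
  by (induction l rule: lst_induct) auto

lemma subst_absent: "x \<notin> free F \<Longrightarrow> subst F m x = F"
  by (induction F) (auto simp: subst_lst_absent intro!: map_idI)

lemma bound_vars_subst [simp]: "bound_vars (subst F m x) = bound_vars F"
  by (induction F) auto

lemma CF_if_bound_vars_disjoint: "bound_vars F \<inter> vars_lst m = {} \<Longrightarrow> CF F m x"
  by (induction F) auto

lemma is_formula_subst:
  assumes "\<And>l. l \<in> L \<Longrightarrow> subst_lst l m x \<in> L"
  shows "is_formula P L F \<Longrightarrow> is_formula P L (subst F m x)"
  by (induction F) (use assms in auto)

section \<open>Coincidence and substitution lemmas\<close>

lemma eval_cong_free: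
  "(\<And>x. x \<in> free F \<Longrightarrow> \<sigma> x = \<tau> x) \<Longrightarrow> eval E R D \<sigma> F = eval E R D \<tau> F"
proof (induction F arbitrary: \<sigma> \<tau>)
  case (Eq l m)
  then show ?case using inst_cong[of l \<sigma> \<tau>] inst_cong[of m \<sigma> \<tau>] by auto
next
  case (Pred p ls)
  then have "map (inst \<sigma>) ls = map (inst \<tau>) ls"
    by (auto intro!: inst_cong)
  then show ?case by (simp only: eval.simps)
next
  case (Forall x F)
  have "eval E R D (\<sigma>(x := d)) F = eval E R D (\<tau>(x := d)) F" for d
    by (rule Forall.IH) (use Forall.prems in auto)
  then show ?case by simp
next
  case (Exists x F)
  have "eval E R D (\<sigma>(x := d)) F = eval E R D (\<tau>(x := d)) F" for d
    by (rule Exists.IH) (use Exists.prems in auto)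
  then show ?case by simp
next
  case (Neg F)
  show ?case using Neg.IH[of \<sigma> \<tau>] Neg.prems by simp
next
  case (Imp F G)
  show ?case using Imp.IH[of \<sigma> \<tau>] Imp.prems by simp
next
  case (Iff F G)
  show ?case using Iff.IH[of \<sigma> \<tau>] Iff.prems by simp
next
  case (Conj F G)
  show ?case using Conj.IH[of \<sigma> \<tau>] Conj.prems by simp
next
  case (Disj F G)
  show ?case using Disj.IH[of \<sigma> \<tau>] Disj.prems by simp
qed

text \<open>The quantifier cases split as \<open>CF\<close> does. If \<open>x\<close> is free, the
  bound variable does not occur in \<open>m\<close>, so updating it leaves the value of
  \<open>m\<close> alone and the two updates commute. Otherwise neither side depends on
  \<open>x\<close>.\<close>

lemma eval_subst:
  "CF F m x \<Longrightarrow> eval E R D \<sigma> (subst F m x) = eval E R D (\<sigma>(x := inst \<sigma> m)) F"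
proof (induction F arbitrary: \<sigma>)
  case (Eq k l)
  then show ?case by (simp add: inst_subst_lst del: fun_upd_apply)
next
  case (Pred p ls)
  then show ?case by (simp add: inst_subst_lst comp_def del: fun_upd_apply)
next
  case (Forall y F)
  show ?case
  proof (cases "x \<in> free (Forall y F)")
    case True
    then have "y \<noteq> x" and cf: "y \<notin> vars_lst m" "CF F m x" using Forall.prems by auto
    moreover have "inst (\<sigma>(y := d)) m = inst \<sigma> m" for d
      by (rule inst_cong) (use cf in auto)
    ultimately show ?thesis
      using Forall.IH[OF cf(2)] fun_upd_twist[OF \<open>y \<noteq> x\<close>, of \<sigma>]
      by (simp del: fun_upd_apply)
  next
    case False
    then have "eval E R D (\<sigma>(x := inst \<sigma> m)) (Forall y F) = eval E R D \<sigma> (Forall y F)"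
      by (intro eval_cong_free) auto
    then show ?thesis by (simp only: subst_absent[OF False])
  qed
next
  case (Exists y F)
  show ?case
  proof (cases "x \<in> free (Exists y F)")
    case True
    then have "y \<noteq> x" and cf: "y \<notin> vars_lst m" "CF F m x" using Exists.prems by auto
    moreover have "inst (\<sigma>(y := d)) m = inst \<sigma> m" for d
      by (rule inst_cong) (use cf in auto)
    ultimately show ?thesis
      using Exists.IH[OF cf(2)] fun_upd_twist[OF \<open>y \<noteq> x\<close>, of \<sigma>]
      by (simp del: fun_upd_apply)
  next
    case False
    then have "eval E R D (\<sigma>(x := inst \<sigma> m)) (Exists y F) = eval E R D \<sigma> (Exists y F)"
      by (intro eval_cong_free) auto
    then show ?thesis by (simp only: subst_absent[OF False])
  qed
qed simp_all

text \<open>The head is the outermost update, mirroring the order in which \<open>fold\<close>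
  substitutes in \<open>replace_pred\<close>. The values of the parameters of \<open>G\<close> come
  from the base assignment.\<close>

fun assign :: "(nat \<Rightarrow> 'a lst) \<Rightarrow> nat list \<Rightarrow> 'a lst list \<Rightarrow> nat \<Rightarrow> 'a lst" where
  "assign \<sigma> (x # xs) (l # ls) = (assign \<sigma> xs ls)(x := l)"
| "assign \<sigma> _ _ = \<sigma>"

lemma assign_absent: "v \<notin> set xs \<Longrightarrow> assign \<sigma> xs ls v = \<sigma> v"
proof (induction xs arbitrary: ls)
  case (Cons x xs)
  then show ?case by (cases ls) auto
qed simp

lemma assign_present: "length ls = length xs \<Longrightarrow> v \<in> set xs \<Longrightarrow> assign \<sigma> xs ls v = assign \<tau> xs ls v"
  by (induction ls xs rule: list_induct2) auto

lemma assign_self: "assign \<sigma> xs (map \<sigma> xs) = \<sigma>"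
  by (induction xs) auto

lemma assign_rel:
  "list_all2 Q ls ms \<Longrightarrow> length ls = length xs \<Longrightarrow> (\<And>v. Q (\<sigma> v) (\<sigma> v)) \<Longrightarrow>
   Q (assign \<sigma> xs ls v) (assign \<sigma> xs ms v)"
proof (induction xs arbitrary: ls ms)
  case (Cons x xs)
  then obtain l ls' m ms' where *: "ls = l # ls'" "ms = m # ms'"
    by (cases ls; cases ms) auto
  then have "Q (assign \<sigma> xs ls' v) (assign \<sigma> xs ms' v)"
    using Cons.IH[of ls' ms'] Cons.prems by auto
  then show ?case using * Cons.prems by auto
qed auto

text \<open>Successive substitution acts as a simultaneous one because no argument contains a later
  substitution variable, and it is collision-free because no argument contains a bound variable of
  \<open>G\<close>. The variable condition of the induction rule provides both.\<close>

lemma eval_fold_subst: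
  assumes "length ls = length xs"
    and "\<And>l. l \<in> set ls \<Longrightarrow> vars_lst l \<inter> (set xs \<union> bound_vars G) = {}"
  shows "eval E R D \<sigma> (fold (\<lambda>(x, l) H. subst H l x) (zip xs ls) G) =
    eval E R D (assign \<sigma> xs (map (inst \<sigma>) ls)) G"
  using assms
proof (induction ls xs arbitrary: G rule: list_induct2)
  case (Cons l ls x xs)
  let ?\<tau> = "assign \<sigma> xs (map (inst \<sigma>) ls)"
  have "eval E R D \<sigma> (fold (\<lambda>(x, l) H. subst H l x) (zip xs ls) (subst G l x)) =
      eval E R D ?\<tau> (subst G l x)"
    by (rule Cons.IH) (use Cons.prems in auto)
  also have "\<dots> = eval E R D (?\<tau>(x := inst ?\<tau> l)) G"
    by (intro eval_subst CF_if_bound_vars_disjoint) (use Cons.prems in auto)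
  also have "inst ?\<tau> l = inst \<sigma> l"
    by (intro inst_cong assign_absent) (use Cons.prems in auto)
  finally show ?case by simp
qed simp

section \<open>Validity of the logical axioms\<close>

lemma eval_prop_inst: "eval E R D \<sigma> (prop_inst s a) = prop_val (\<lambda>n. eval E R D \<sigma> (s n)) a"
  by (induction a) auto

lemma eval_prop_axiom: "F \<in> prop_axioms \<Longrightarrow> eval E R D \<sigma> F"
  by (auto simp: prop_axioms_def eval_prop_inst)

lemma eval_quantifier_axiom:
  assumes "F \<in> quantifier_axioms" "range \<sigma> \<subseteq> D"
  shows "eval E R D \<sigma> F"
proof -
  consider (inst) x F' where "F = Imp (Forall x F') F'"
    | (dist) x F' G where "F = Imp (Forall x (Imp F' G)) (Imp F' (Forall x G))" "x \<notin> free F'"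
    | (ex) x F' where "F = Iff (Neg (Forall x (Neg F'))) (Exists x F')"
    using assms(1) unfolding quantifier_axioms_def by auto
  then show ?thesis
  proof cases
    case inst
    have "\<sigma> x \<in> D" using assms(2) by auto
    then show ?thesis using inst by (metis eval.simps(4,8) fun_upd_triv)
  next
    case dist
    have "eval E R D (\<sigma>(x := d)) F' = eval E R D \<sigma> F'" for d
      by (rule eval_cong_free) (use dist in auto)
    then show ?thesis using dist by auto
  qed auto
qed


section \<open>Derivations\<close>

text \<open>Complete induction on the position of a line. \<open>step\<close> is left abstract so
  that the principle serves R-derivations as well as proofs of \<open>M\<close>.\<close>

lemma derivation_induct:
  assumes "\<forall>k<length Fs. ok (Fs ! k) \<and> step (set (take k Fs)) (Fs ! k)"
    and "\<And>\<Gamma> F. ok F \<Longrightarrow> step \<Gamma> F \<Longrightarrow> \<Gamma> \<subseteq> set Fs \<Longrightarrow> (\<And>G. G \<in> \<Gamma> \<Longrightarrow> Q G) \<Longrightarrow> Q F"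
    and "F \<in> set Fs"
  shows "Q F"
proof -
  have "Q (Fs ! k)" if "k < length Fs" for k
    using that
  proof (induction k rule: less_induct)
    case (less k)
    show ?case
    proof (rule assms(2))
      show "ok (Fs ! k)" "step (set (take k Fs)) (Fs ! k)" using assms(1) less.prems by auto
      show "set (take k Fs) \<subseteq> set Fs" by (rule set_take_subset)
      fix G assume "G \<in> set (take k Fs)"
      then show "Q G" using less by (auto simp: in_set_conv_nth)
    qed
  qed
  then show ?thesis using assms(3) by (auto simp: in_set_conv_nth)
qed

lemma Pi_R_induct [consumes 1, case_names step]:
  assumes "F \<in> Pi_R S L"
    and "\<And>\<Gamma> F. is_rformula F \<Longrightarrow> is_formula (r_preds S) L F \<Longrightarrow> r_step S L \<Gamma> F \<Longrightarrow>
      \<Gamma> \<subseteq> Pi_R S L \<Longrightarrow> (\<And>G. G \<in> \<Gamma> \<Longrightarrow> Q G) \<Longrightarrow> Q F"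
  shows "Q F"
proof -
  obtain Fs where Fs: "r_derivation S L Fs" "F \<in> set Fs" using assms(1) by (auto simp: Pi_R_def)
  then have sub: "set Fs \<subseteq> Pi_R S L" by (auto simp: Pi_R_def)
  show ?thesis
    by (rule derivation_induct[where Fs = Fs and step = "r_step S L"
          and ok = "\<lambda>F. is_rformula F \<and> is_formula (r_preds S) L F"])
      (use Fs sub assms(2) in \<open>auto simp: r_derivation_def\<close>)
qed

lemma Pi_R_formula: "F \<in> Pi_R S L \<Longrightarrow> is_rformula F \<and> is_formula (r_preds S) L F"
  by (induction rule: Pi_R_induct) simp

lemma r_step_mono: "r_step S L \<Gamma> F \<Longrightarrow> \<Gamma> \<subseteq> \<Delta> \<Longrightarrow> r_step S L \<Delta> F"
  by (induction rule: r_step.induct) (auto intro: r_step.intros)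

lemma r_derivation_append:
  assumes "r_derivation S L Fs" "r_derivation S L Gs"
  shows "r_derivation S L (Fs @ Gs)"
  unfolding r_derivation_def
proof (intro allI impI)
  fix k assume k: "k < length (Fs @ Gs)"
  show "is_rformula ((Fs @ Gs) ! k) \<and> is_formula (r_preds S) L ((Fs @ Gs) ! k) \<and>
    r_step S L (set (take k (Fs @ Gs))) ((Fs @ Gs) ! k)"
  proof (cases "k < length Fs")
    case True
    then show ?thesis using assms(1) by (simp add: r_derivation_def nth_append)
  next
    case False
    then have "k - length Fs < length Gs" using k by auto
    then show ?thesis using assms(2) False
      by (auto simp: r_derivation_def nth_append intro: r_step_mono)
  qed
qed

lemma r_derivation_snoc:
  assumes "r_derivation S L Fs" "r_step S L (set Fs) F"
    "is_rformula F" "is_formula (r_preds S) L F"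
  shows "r_derivation S L (Fs @ [F])"
  using assms by (auto simp: r_derivation_def nth_append less_Suc_eq)

text \<open>The premises of a step may come from different derivations. Concatenation yields a
  common one, since a step remains correct when more formulas are available.\<close>

lemma finite_Pi_R_derivation:
  "finite \<Gamma> \<Longrightarrow> \<Gamma> \<subseteq> Pi_R S L \<Longrightarrow> \<exists>Fs. r_derivation S L Fs \<and> \<Gamma> \<subseteq> set Fs"
proof (induction rule: finite_induct)
  case empty
  have "r_derivation S L []" by (simp add: r_derivation_def)
  then show ?case by auto
next
  case (insert F \<Gamma>)
  then obtain Fs Gs where "r_derivation S L Fs" "\<Gamma> \<subseteq> set Fs" "r_derivation S L Gs" "F \<in> set Gs"
    by (auto simp: Pi_R_def)
  then show ?case
    by (intro exI[of _ "Fs @ Gs"]) (auto intro: r_derivation_append)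
qed

lemma Pi_R_step:
  assumes "r_step S L \<Gamma> F" "finite \<Gamma>" "\<Gamma> \<subseteq> Pi_R S L"
    "is_rformula F" "is_formula (r_preds S) L F"
  shows "F \<in> Pi_R S L"
proof -
  obtain Fs where Fs: "r_derivation S L Fs" "\<Gamma> \<subseteq> set Fs"
    using finite_Pi_R_derivation assms by blast
  then have "r_derivation S L (Fs @ [F])"
    by (intro r_derivation_snoc) (use assms in \<open>auto intro: r_step_mono\<close>)
  then show ?thesis unfolding Pi_R_def by fastforce
qed

lemma Pi_R_axiom:
  "F \<in> r_basis S \<union> equality_axioms \<Longrightarrow> is_rformula F \<Longrightarrow> is_formula (r_preds S) L F \<Longrightarrow>
   F \<in> Pi_R S L"
  by (rule Pi_R_step[of S L "{}"]) (auto intro: r_step.intros)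

lemma Pi_R_mp:
  assumes "F \<in> Pi_R S L" "Imp F G \<in> Pi_R S L"
  shows "G \<in> Pi_R S L"
  by (rule Pi_R_step[of S L "{F, Imp F G}"])
    (use assms Pi_R_formula[OF assms(2)] in \<open>auto intro: r_step.intros\<close>)

section \<open>R-formulas as quantifier-free formulas\<close>

lemma is_prime_subst: "is_prime F \<Longrightarrow> is_prime (subst F m x)"
  by (cases F) auto

lemma is_rformula_subst: "is_rformula F \<Longrightarrow> is_rformula (subst F m x)"
  by (induction F) (auto simp: is_prime_subst)

lemma bound_vars_prime: "is_prime F \<Longrightarrow> bound_vars F = {}"
  by (cases F) auto

lemma bound_vars_rformula: "is_rformula F \<Longrightarrow> bound_vars F = {}"
  by (induction F) (auto simp: bound_vars_prime)

lemma CF_rformula: "is_rformula F \<Longrightarrow> CF F m x"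
  by (simp add: CF_if_bound_vars_disjoint bound_vars_rformula)

lemma is_rformula_prime: "is_prime F \<Longrightarrow> is_rformula F"
  by (cases F) auto

lemma free_subst_ground: "is_rformula F \<Longrightarrow> vars_lst m = {} \<Longrightarrow> free (subst F m x) = free F - {x}"
proof (induction F)
  case (Imp F G)
  then show ?case by (cases F) (auto simp: vars_subst_lst split: if_splits)
qed (auto simp: vars_subst_lst split: if_splits)

lemma equality_axiom_rformula: "F \<in> equality_axioms \<Longrightarrow> is_rformula F"
  by (auto simp: equality_axioms_def is_prime_subst is_rformula_prime)

text \<open>Each R-rule is a special case of a rule of \<open>M\<close>. The one new side condition,
  \<open>CF\<close>, holds because R-formulas bind no variables.\<close>

lemma Pi_R_subset_Pi_M:
  fixes S :: "('a, 'p) rec_sys" and M :: "('a, 'p) math_sys"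
  assumes "r_preds S \<subseteq> m_preds M" "r_basis S \<subseteq> m_basis M"
  shows "Pi_R S L \<subseteq> Pi_M M L"
proof -
  have form: "is_formula (m_preds M) L F" if "is_formula (r_preds S) L F" for F :: "('a, 'p) fm"
    using that by (induction F) (use assms(1) in auto)
  have "m_step M L \<Gamma> F" if "r_step S L \<Gamma> F" "\<And>G. G \<in> \<Gamma> \<Longrightarrow> is_rformula G" for \<Gamma> F
    using that(1)
  proof cases
    case r_axiom
    then show ?thesis using assms(2) by (auto intro: m_axiom)
  next
    case (r_mp F')
    then show ?thesis by (auto intro: m_mp)
  next
    case (r_subst F' m x)
    then show ?thesis using that(2) by (auto intro: m_subst CF_rformula)
  qed
  moreover have "is_rformula G" if "r_derivation S L Fs" "G \<in> set (take k Fs)" for Fs G k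
    using that set_take_subset[of k Fs] by (auto simp: r_derivation_def in_set_conv_nth)
  ultimately have "m_proof M L Fs" if "r_derivation S L Fs" for Fs
    using that form by (fastforce simp: m_proof_def r_derivation_def)
  then show ?thesis by (auto simp: Pi_R_def Pi_M_def)
qed


section \<open>The structure of ground lists\<close>

locale ground_structure =
  fixes S :: "('a, 'p) rec_sys" and L :: "'a lst set"
  assumes basis_rformula: "F \<in> r_basis S \<Longrightarrow> is_rformula F"
    and Var_in_L: "[Var x] \<in> L"
    and subst_in_L: "l \<in> L \<Longrightarrow> m \<in> L \<Longrightarrow> subst_lst l m x \<in> L"
begin

abbreviation "D \<equiv> ground_lists L"
text \<open>Equality is interpreted by derivability and not by identity, which avoids a quotient. In
  return, \<open>truth_eqv\<close> has to show that formulas respect it.\<close>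

abbreviation eqv :: "'a lst \<Rightarrow> 'a lst \<Rightarrow> bool" where "eqv l m \<equiv> Eq l m \<in> Pi_R S L"
abbreviation holds :: "'p \<Rightarrow> 'a lst list \<Rightarrow> bool" where "holds p ls \<equiv> Pred p ls \<in> Pi_R S L"
abbreviation truth :: "(nat \<Rightarrow> 'a lst) \<Rightarrow> ('a, 'p) fm \<Rightarrow> bool" where
  "truth \<equiv> eval eqv holds D"

text \<open>Closure of \<open>L\<close> concerns one variable at a time. Substituting the ground
  list \<open>\<sigma> x\<close> for \<open>x\<close> removes \<open>x\<close>, adds no variable and
  does not change the value under \<open>inst \<sigma>\<close>.\<close>

lemma inst_in_D:
  assumes "range \<sigma> \<subseteq> D" "l \<in> L"
  shows "inst \<sigma> l \<in> D"
proof -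
  have ground: "vars_lst (\<sigma> x) = {}" "\<sigma> x \<in> L" for x
    using assms(1) by (auto simp: ground_lists_def)
  have "inst \<sigma> l \<in> L"
    using assms(2)
  proof (induction "card (vars_lst l)" arbitrary: l)
    case 0
    then show ?case by simp
  next
    case (Suc n)
    then obtain x where x: "x \<in> vars_lst l" by fastforce
    have "inst \<sigma> (subst_lst l (\<sigma> x) x) \<in> L"
      by (rule Suc.hyps(1)) (use Suc x ground in \<open>auto simp: vars_subst_lst intro: subst_in_L\<close>)
    then show ?case using ground by (simp add: inst_subst_lst)
  qed
  then show ?thesis using ground by (simp add: ground_lists_def vars_inst)
qed

lemma Pi_R_subst: "F \<in> Pi_R S L \<Longrightarrow> m \<in> L \<Longrightarrow> subst F m x \<in> Pi_R S L"
  by (rule Pi_R_step[of S L "{F}"])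
    (auto intro: r_step.intros is_rformula_subst is_formula_subst subst_in_L dest: Pi_R_formula)

lemma truth_closed_prime:
  "is_prime F \<Longrightarrow> free F = {} \<Longrightarrow> truth \<sigma> F \<longleftrightarrow> F \<in> Pi_R S L"
proof (cases F)
  case (Pred p ls)
  moreover assume "free F = {}"
  ultimately have "map (inst \<sigma>) ls = ls" by (intro map_idI) auto
  then show ?thesis using Pred by simp
qed auto

text \<open>The antecedents of a closed R-formula are closed and prime, so a true antecedent is
  derivable and modus ponens derives the rest.\<close>

lemma truth_closed: "F \<in> Pi_R S L \<Longrightarrow> free F = {} \<Longrightarrow> truth \<sigma> F"
proof (induction F)
  case (Imp F G)
  then have "is_prime F" using Pi_R_formula by fastforce
  then show ?case using Imp truth_closed_prime[of F \<sigma>] Pi_R_mp[of F S L G] by auto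
next
  case (Eq l m)
  then show ?case using truth_closed_prime by simp
next
  case (Pred p ls)
  then show ?case using truth_closed_prime[of "Pred p ls" \<sigma>] by simp
qed (auto dest!: Pi_R_formula)

text \<open>The substitution rule replaces the free variables one by one by their ground values
  under \<open>\<sigma>\<close>, which reduces the claim to closed formulas.\<close>

lemma truth_Pi_R:
  assumes "range \<sigma> \<subseteq> D" "F \<in> Pi_R S L"
  shows "truth \<sigma> F"
  using assms(2)
proof (induction "card (free F)" arbitrary: F)
  case 0
  then show ?case by (simp add: truth_closed)
next
  case (Suc n)
  then obtain x where x: "x \<in> free F" by fastforce
  have \<sigma>x: "\<sigma> x \<in> L" "vars_lst (\<sigma> x) = {}" using assms(1) by (auto simp: ground_lists_def)
  have F: "is_rformula F" using Suc.prems Pi_R_formula by blast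
  have "truth \<sigma> (subst F (\<sigma> x) x)"
    by (rule Suc.hyps(1)) (use Suc x \<sigma>x F in \<open>auto simp: free_subst_ground intro: Pi_R_subst\<close>)
  then show ?case using \<sigma>x F by (simp add: eval_subst CF_rformula)
qed

section \<open>Derivable equality as a congruence\<close>

lemma eqv_refl:
  assumes "l \<in> D"
  shows "eqv l l"
proof -
  have "truth (\<lambda>_. l) (Eq [Var 0] [Var 0])"
    by (intro truth_Pi_R Pi_R_axiom) (use assms Var_in_L in \<open>auto simp: equality_axioms_def\<close>)
  then show ?thesis by simp
qed

text \<open>The substitutivity axiom speaks of two variables only, so \<open>m\<close> is made the
  value of a fresh variable \<open>y\<close>, which does not disturb \<open>F\<close>.\<close>

lemma truth_replace:
  assumes "is_prime F" "is_formula (r_preds S) L F" "range \<sigma> \<subseteq> D" "m \<in> D" "eqv (\<sigma> x) m" "truth \<sigma> F"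
  shows "truth (\<sigma>(x := m)) F"
proof -
  obtain y where y: "y \<notin> insert x (free F)"
    using ex_new_if_finite[of "insert x (free F)"] by auto
  let ?\<tau> = "\<sigma>(y := m)"
  have "truth ?\<tau> (Imp (Eq [Var x] [Var y]) (Imp F (subst F [Var y] x)))"
  proof (intro truth_Pi_R Pi_R_axiom)
    show "range ?\<tau> \<subseteq> D" using assms by auto
    show ax: "Imp (Eq [Var x] [Var y]) (Imp F (subst F [Var y] x)) \<in> r_basis S \<union> equality_axioms"
      using assms(1) by (auto simp: equality_axioms_def)
    show "is_rformula (Imp (Eq [Var x] [Var y]) (Imp F (subst F [Var y] x)))"
      using assms(1) by (simp add: is_prime_subst is_rformula_prime)
    show "is_formula (r_preds S) L (Imp (Eq [Var x] [Var y]) (Imp F (subst F [Var y] x)))"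
      using assms(2) Var_in_L by (simp add: is_formula_subst subst_in_L)
  qed
  moreover have "truth ?\<tau> F \<longleftrightarrow> truth \<sigma> F"
    by (rule eval_cong_free) (use y in auto)
  moreover have "truth ?\<tau> (subst F [Var y] x) \<longleftrightarrow> truth (?\<tau>(x := m)) F"
    using eval_subst[of F "[Var y]" x] assms(1) by (simp add: CF_rformula is_rformula_prime)
  moreover have "truth (?\<tau>(x := m)) F \<longleftrightarrow> truth (\<sigma>(x := m)) F"
    by (rule eval_cong_free) (use y in auto)
  ultimately show ?thesis using assms y by auto
qed

lemma eqv_sym:
  assumes "l \<in> D" "m \<in> D" "eqv l m"
  shows "eqv m l"
proof -
  \<comment> \<open>Start from \<open>eqv l l\<close> and replace only the left occurrence of
    \<open>l\<close>.\<close>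
  have "truth ((\<lambda>_. l)(0 := m)) (Eq [Var 0] [Var 1])"
    by (rule truth_replace) (use assms Var_in_L eqv_refl in auto)
  then show ?thesis by simp
qed

lemma truth_eqv_prime:
  assumes "is_prime F" "is_formula (r_preds S) L F" "range \<sigma> \<subseteq> D" "range \<tau> \<subseteq> D"
    "\<And>x. eqv (\<sigma> x) (\<tau> x)" "truth \<sigma> F"
  shows "truth \<tau> F"
proof -
  \<comment> \<open>\<open>truth_replace\<close> changes one variable at a time. Finitely many
    changes suffice, since only the free variables of \<open>F\<close> matter.\<close>
  have "truth (\<lambda>x. if x \<in> A then \<tau> x else \<sigma> x) F" if "finite A" for A
    using that
  proof (induction A)
    case empty
    then show ?case using assms by simp
  next
    case (insert y A)
    let ?\<rho> = "\<lambda>x. if x \<in> A then \<tau> x else \<sigma> x"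
    have "truth (?\<rho>(y := \<tau> y)) F"
      by (rule truth_replace) (use assms insert in auto)
    moreover have "?\<rho>(y := \<tau> y) = (\<lambda>x. if x \<in> insert y A then \<tau> x else \<sigma> x)" by auto
    ultimately show ?case by simp
  qed
  from this[of "free F"] have "truth (\<lambda>x. if x \<in> free F then \<tau> x else \<sigma> x) F" by simp
  also have "truth (\<lambda>x. if x \<in> free F then \<tau> x else \<sigma> x) F = truth \<tau> F"
    by (rule eval_cong_free) simp
  finally show ?thesis .
qed

text \<open>Needed for the arbitrary formula \<open>G\<close> of the induction rule. Symmetry turns
  the implication for prime formulas into an equivalence, which then passes through negation and the
  other connectives; under a quantifier both assignments receive the same value.\<close>

lemma truth_eqv:
  assumes "is_formula (r_preds S) L F" "range \<sigma> \<subseteq> D" "range \<tau> \<subseteq> D" "\<And>x. eqv (\<sigma> x) (\<tau> x)"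
  shows "truth \<sigma> F \<longleftrightarrow> truth \<tau> F"
  using assms
proof (induction F arbitrary: \<sigma> \<tau>)
  case (Eq l m)
  have sym: "eqv (\<tau> x) (\<sigma> x)" for x
    by (rule eqv_sym[OF Eq.prems(2,3)[THEN range_subsetD] Eq.prems(4)])
  have prime: "is_prime (Eq l m)" by simp
  show ?case
    using truth_eqv_prime[OF prime Eq.prems(1,2,3,4)] truth_eqv_prime[OF prime Eq.prems(1,3,2) sym]
    by blast
next
  case (Pred p ls)
  have sym: "eqv (\<tau> x) (\<sigma> x)" for x
    by (rule eqv_sym[OF Pred.prems(2,3)[THEN range_subsetD] Pred.prems(4)])
  have prime: "is_prime (Pred p ls)" by simp
  show ?case
    using truth_eqv_prime[OF prime Pred.prems(1,2,3,4)] truth_eqv_prime[OF prime Pred.prems(1,3,2) sym]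
    by blast
next
  case (Forall x F)
  have "truth (\<sigma>(x := d)) F \<longleftrightarrow> truth (\<tau>(x := d)) F" if "d \<in> D" for d
    by (rule Forall.IH) (use Forall.prems that eqv_refl in auto)
  then show ?case by simp
next
  case (Exists x F)
  have "truth (\<sigma>(x := d)) F \<longleftrightarrow> truth (\<tau>(x := d)) F" if "d \<in> D" for d
    by (rule Exists.IH) (use Exists.prems that eqv_refl in auto)
  then show ?case by simp
next
  case (Neg F)
  show ?case using Neg.IH[of \<sigma> \<tau>] Neg.prems by simp
next
  case (Imp F G)
  show ?case using Imp.IH[of \<sigma> \<tau>] Imp.prems by simp
next
  case (Iff F G)
  show ?case using Iff.IH[of \<sigma> \<tau>] Iff.prems by simp
next
  case (Conj F G)
  show ?case using Conj.IH[of \<sigma> \<tau>] Conj.prems by simp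
next
  case (Disj F G)
  show ?case using Disj.IH[of \<sigma> \<tau>] Disj.prems by simp
qed

lemma eqv_inst:
  assumes "range \<sigma> \<subseteq> D" "range \<tau> \<subseteq> D" "\<And>x. eqv (\<sigma> x) (\<tau> x)" "l \<in> L"
  shows "eqv (inst \<sigma> l) (inst \<tau> l)"
proof -
  have "inst \<sigma> l \<in> D" using assms by (simp add: inst_in_D)
  then have "inst \<sigma> l \<in> L" "vars_lst (inst \<sigma> l) = {}" "eqv (inst \<sigma> l) (inst \<sigma> l)"
    by (auto simp: ground_lists_def eqv_refl)
  then show ?thesis
    \<comment> \<open>The left side of this equation is ground, so passing from
      \<open>\<sigma>\<close> to \<open>\<tau>\<close> affects only the right side.\<close>
    using truth_eqv[of "Eq (inst \<sigma> l) l" \<sigma> \<tau>] assms by simp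
qed

end


section \<open>Soundness of induction\<close>

text \<open>\<open>\<sigma>\<close> fixes the parameters of \<open>G\<close> while other formulas
  are evaluated under varying \<open>\<tau>\<close>. The premises of the rule enter only through
  their validity, as \<open>replaced\<close>.\<close>

locale induction_rule = ground_structure +
  fixes p :: 'b and xs :: "nat list" and G :: "('a, 'b) fm" and \<sigma> :: "nat \<Rightarrow> 'a lst"
  assumes G: "is_formula (r_preds S) L G"
    and disjoint: "F \<in> r_basis S \<Longrightarrow> (set xs \<union> vars G) \<inter> vars F = {}"
    and replaced: "F \<in> r_basis S \<Longrightarrow> length ls = length xs \<Longrightarrow> rconclusion F = Pred p ls \<Longrightarrow>
      range \<tau> \<subseteq> D \<Longrightarrow> truth \<tau> (replace_pred p xs G F)"
    and range: "range \<sigma> \<subseteq> D"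
begin

text \<open>The guard on the length leaves occurrences of \<open>p\<close> with another arity
  unchanged.\<close>

definition holds' :: "'b \<Rightarrow> 'a lst list \<Rightarrow> bool" where
  "holds' q ls \<longleftrightarrow> holds q ls \<and> (q = p \<and> length ls = length xs \<longrightarrow> truth (assign \<sigma> xs ls) G)"

abbreviation truth' :: "(nat \<Rightarrow> 'a lst) \<Rightarrow> ('a, 'b) fm \<Rightarrow> bool" where
  "truth' \<equiv> eval eqv holds' D"

lemma range_assign: "set ls \<subseteq> D \<Longrightarrow> range (assign \<sigma> xs ls) \<subseteq> D"
proof (induction xs arbitrary: ls)
  case (Cons x xs)
  then show ?case
  proof (cases ls)
    case (Cons l ls')
    then have "range (assign \<sigma> xs ls') \<subseteq> D" "l \<in> D" using Cons.IH Cons.prems by auto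
    then show ?thesis using Cons by auto
  qed (use range in simp)
qed (use range in simp)

lemma truth'_imp_truth: "is_prime F \<Longrightarrow> truth' \<tau> F \<Longrightarrow> truth \<tau> F"
  by (cases F) (auto simp: holds'_def)

text \<open>\<open>V\<close> will contain the variables of a basis axiom. As these are disjoint from
  \<open>xs\<close> and the variables of \<open>G\<close>, one mixed assignment can evaluate the
  arguments by \<open>\<tau>\<close> and the parameters of \<open>G\<close> by
  \<open>\<sigma>\<close>.\<close>

lemma truth_replace_pred:
  assumes "(set xs \<union> vars G) \<inter> V = {}" "(\<Union>l\<in>set ls. vars_lst l) \<subseteq> V" "length ls = length xs"
  shows "truth (\<lambda>v. if v \<in> V then \<tau> v else \<sigma> v) (replace_pred p xs G (Pred p ls)) \<longleftrightarrow>
    truth (assign \<sigma> xs (map (inst \<tau>) ls)) G"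
proof -
  let ?\<rho> = "\<lambda>v. if v \<in> V then \<tau> v else \<sigma> v"
  have "vars_lst l \<inter> (set xs \<union> bound_vars G) = {}" if "l \<in> set ls" for l
    using assms that bound_vars_subset_vars[of G] by blast
  then have "truth ?\<rho> (replace_pred p xs G (Pred p ls)) \<longleftrightarrow>
      truth (assign ?\<rho> xs (map (inst ?\<rho>) ls)) G"
    using assms(3) by (simp add: eval_fold_subst)
  also have "map (inst ?\<rho>) ls = map (inst \<tau>) ls"
    using assms(2) by (intro map_cong refl inst_cong) auto
  also have "truth (assign ?\<rho> xs (map (inst \<tau>) ls)) G \<longleftrightarrow> truth (assign \<sigma> xs (map (inst \<tau>) ls)) G"
  proof (rule eval_cong_free)
    fix v assume "v \<in> free G"
    then have "v \<notin> V" using assms(1) free_subset_vars[of G] by auto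
    then show "assign ?\<rho> xs (map (inst \<tau>) ls) v = assign \<sigma> xs (map (inst \<tau>) ls) v"
      using assms(3)
      by (cases "v \<in> set xs") (auto simp: assign_absent intro!: assign_present)
  qed
  finally show ?thesis .
qed

lemma truth'_prime:
  assumes "is_prime F" "(set xs \<union> vars G) \<inter> V = {}" "vars F \<subseteq> V" "truth \<tau> F"
    and "\<And>ls. length ls = length xs \<Longrightarrow> F = Pred p ls \<Longrightarrow>
      truth (\<lambda>v. if v \<in> V then \<tau> v else \<sigma> v) (replace_pred p xs G F)"
  shows "truth' \<tau> F"
proof (cases F)
  case (Pred q ls)
  show ?thesis
  proof (cases "q = p \<and> length ls = length xs")
    case True
    then have "truth (assign \<sigma> xs (map (inst \<tau>) ls)) G"
      using truth_replace_pred[of V ls \<tau>] assms(2,3) assms(5)[of ls] Pred by auto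
    then show ?thesis using assms(4) Pred by (simp add: holds'_def)
  qed (use assms(4) Pred in \<open>auto simp: holds'_def\<close>)
qed (use assms in auto)

lemma truth'_replace_pred:
  assumes "is_prime F" "(set xs \<union> vars G) \<inter> V = {}" "vars F \<subseteq> V" "truth' \<tau> F"
  shows "truth (\<lambda>v. if v \<in> V then \<tau> v else \<sigma> v) (replace_pred p xs G F)"
proof (cases "\<exists>ls. length ls = length xs \<and> F = Pred p ls")
  case True
  then obtain ls where F: "F = Pred p ls" "length ls = length xs" by auto
  then show ?thesis
    using truth_replace_pred[of V ls \<tau>] assms by (simp add: holds'_def)
next
  case False
  then have "replace_pred p xs G F = F" using assms(1) by (cases F) auto
  moreover have "truth (\<lambda>v. if v \<in> V then \<tau> v else \<sigma> v) F \<longleftrightarrow> truth \<tau> F"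
    by (rule eval_cong_free) (use assms free_subset_vars[of F] in auto)
  ultimately show ?thesis using assms truth'_imp_truth by simp
qed

text \<open>An antecedent true in the smaller structure is true in the original one, and so is its
  replaced form. Hence both the truth of the axiom and that of its replaced form pass on to the
  conclusion. The replaced form is consulted only if the conclusion is an \<open>i\<close>-ary
  \<open>p\<close>, just as the rule demands premises only for such axioms.\<close>

lemma truth'_rformula:
  assumes "is_rformula F" "(set xs \<union> vars G) \<inter> V = {}" "vars F \<subseteq> V" "truth \<tau> F"
    and "\<And>ls. length ls = length xs \<Longrightarrow> rconclusion F = Pred p ls \<Longrightarrow>
      truth (\<lambda>v. if v \<in> V then \<tau> v else \<sigma> v) (replace_pred p xs G F)"
  shows "truth' \<tau> F"
  using assms
proof (induction F)
  case (Eq l m)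
  then show ?case by simp
next
  case (Pred q ls)
  show ?case by (rule truth'_prime[of _ V]) (use Pred in auto)
next
  case (Imp A B)
  show ?case
  proof (simp only: eval.simps, intro impI)
    assume A: "truth' \<tau> A"
    have prime: "is_prime A" using Imp.prems by simp
    have "truth (\<lambda>v. if v \<in> V then \<tau> v else \<sigma> v) (replace_pred p xs G A)"
      by (rule truth'_replace_pred) (use prime A Imp.prems in auto)
    then show "truth' \<tau> B"
      using Imp.IH(2) Imp.prems A truth'_imp_truth[OF prime A] by auto
  qed
qed auto

lemma truth'_basis:
  assumes "F \<in> r_basis S" "F \<in> Pi_R S L" "range \<tau> \<subseteq> D"
  shows "truth' \<tau> F"
proof (rule truth'_rformula[of F "vars F"])
  have \<rho>: "range (\<lambda>v. if v \<in> vars F then \<tau> v else \<sigma> v) \<subseteq> D"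
    using range assms(3) by auto
  show "truth (\<lambda>v. if v \<in> vars F then \<tau> v else \<sigma> v) (replace_pred p xs G F)"
    if "length ls = length xs" "rconclusion F = Pred p ls" for ls
    using replaced[OF assms(1) that \<rho>] .
qed (use assms(1) disjoint basis_rformula truth_Pi_R[OF assms(3,2)] in auto)

lemma truth'_equality:
  assumes "F \<in> equality_axioms" "F \<in> Pi_R S L" "range \<tau> \<subseteq> D"
  shows "truth' \<tau> F"
proof -
  have truth: "truth \<tau> F" using assms truth_Pi_R by blast
  consider (refl) x where "F = Eq [Var x] [Var x]"
    | (subst) x y F' where "F = Imp (Eq [Var x] [Var y]) (Imp F' (subst F' [Var y] x))" "is_prime F'"
    using assms(1) by (auto simp: equality_axioms_def)
  then show ?thesis
  proof cases
    case refl
    then show ?thesis using truth by simp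
  next
    case subst
    let ?\<tau>' = "\<tau>(x := \<tau> y)"
    show ?thesis
    proof (cases F')
      case (Pred q ls)
      have inst: "map (inst \<tau>) (map (\<lambda>l. subst_lst l [Var y] x) ls) = map (inst ?\<tau>') ls"
        by (simp add: inst_subst_lst)
      have ls: "set ls \<subseteq> L" using Pi_R_formula[OF assms(2)] subst(1) Pred by simp
      have \<tau>': "range ?\<tau>' \<subseteq> D" using assms(3) by auto
      have "holds' q (map (inst ?\<tau>') ls)" if eq: "eqv (\<tau> x) (\<tau> y)" and h: "holds' q (map (inst \<tau>) ls)"
      proof -
        \<comment> \<open>Replacing \<open>x\<close> by \<open>y\<close> amounts to passing to a
          pointwise equal assignment, so all arguments, and with them the truth of \<open>G\<close>,
          are preserved.\<close>
        have pw: "eqv (\<tau> v) (?\<tau>' v)" for v using eq assms(3) eqv_refl by auto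
        have "truth (assign \<sigma> xs (map (inst \<tau>) ls)) G \<longleftrightarrow> truth (assign \<sigma> xs (map (inst ?\<tau>') ls)) G"
          if len: "length ls = length xs"
        proof (rule truth_eqv[OF G])
          show "range (assign \<sigma> xs (map (inst \<tau>) ls)) \<subseteq> D"
            by (rule range_assign) (use ls assms(3) inst_in_D in auto)
          show "range (assign \<sigma> xs (map (inst ?\<tau>') ls)) \<subseteq> D"
            by (rule range_assign) (use ls \<tau>' inst_in_D in auto)
          fix v
          show "eqv (assign \<sigma> xs (map (inst \<tau>) ls) v) (assign \<sigma> xs (map (inst ?\<tau>') ls) v)"
          proof (rule assign_rel)
            show "list_all2 eqv (map (inst \<tau>) ls) (map (inst ?\<tau>') ls)"
              unfolding list_all2_conv_all_nth
              using eqv_inst[OF assms(3) \<tau>' pw] ls nth_mem by (metis length_map nth_map subsetD)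
          qed (use len range eqv_refl in auto)
        qed
        moreover have "holds q (map (inst ?\<tau>') ls)"
          using truth h eq unfolding subst(1) Pred holds'_def subst.simps eval.simps inst by simp
        ultimately show ?thesis using h by (simp add: holds'_def)
      qed
      then show ?thesis unfolding subst(1) Pred subst.simps eval.simps inst by simp
    qed (use truth subst in simp_all)
  qed
qed

text \<open>Unlike in \<open>truth_Pi_R\<close>, derivability of the closed instances does not
  immediately give truth in the smaller structure, so the derivation is followed rule by
  rule.\<close>

lemma truth'_Pi_R:
  assumes "F \<in> Pi_R S L" "range \<tau> \<subseteq> D"
  shows "truth' \<tau> F"
  using assms
proof (induction arbitrary: \<tau> rule: Pi_R_induct)
  case (step \<Gamma> F)
  from \<open>r_step S L \<Gamma> F\<close> show ?case
  proof cases
    case r_axiom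
    then show ?thesis
      using step truth'_basis truth'_equality Pi_R_axiom by (metis UnE)
  next
    case (r_mp A)
    then show ?thesis using step.IH[of A \<tau>] step.IH[of "Imp A F" \<tau>] step.prems by simp
  next
    case (r_subst A m x)
    then have "truth' (\<tau>(x := inst \<tau> m)) A"
      by (intro step.IH) (use step.prems inst_in_D in auto)
    moreover have "is_rformula A" using r_subst step Pi_R_formula by blast
    ultimately show ?thesis using r_subst by (simp add: eval_subst CF_rformula)
  qed
qed

lemma truth_induct: "truth \<sigma> (Imp (Pred p (map (\<lambda>x. [Var x]) xs)) G)"
proof (simp add: comp_def, intro impI)
  assume "holds p (map \<sigma> xs)"
  \<comment> \<open>For this ground formula, truth in the smaller structure includes
    \<open>G\<close> with the values \<open>map \<sigma> xs\<close> assigned to \<open>xs\<close>,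
    and that assignment is \<open>\<sigma>\<close> itself.\<close>
  then have "truth' \<sigma> (Pred p (map \<sigma> xs))" using truth'_Pi_R range by blast
  moreover have "vars_lst (\<sigma> x) = {}" for x
    using range_subsetD[OF range, of x] by (simp add: ground_lists_def)
  then have "map (inst \<sigma>) (map \<sigma> xs) = map \<sigma> xs" by simp
  ultimately have "holds' p (map \<sigma> xs)" by (simp only: eval.simps)
  then show "truth \<sigma> G" by (simp add: holds'_def assign_self)
qed

end


section \<open>Soundness of mathematical systems\<close>

lemma (in ground_structure) truth_Pi_M:
  assumes M: "m_rec M = S" "m_preds M = r_preds S" "m_basis M = r_basis S"
    and "F \<in> Pi_M M L" "range \<sigma> \<subseteq> D"
  shows "truth \<sigma> F"
proof -
  obtain Fs where Fs: "m_proof M L Fs" "F \<in> set Fs" using assms(4) by (auto simp: Pi_M_def)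
  \<comment> \<open>The assignment is quantified inside the induction, since substitution,
    generalization and the induction rule use their premises under other assignments.\<close>
  have "\<forall>\<sigma>. range \<sigma> \<subseteq> D \<longrightarrow> truth \<sigma> F"
  proof (rule derivation_induct[where Fs = Fs and step = "m_step M L"
        and ok = "is_formula (m_preds M) L"])
    fix \<Gamma> F
    assume F: "is_formula (m_preds M) L F" and step: "m_step M L \<Gamma> F"
      and IH: "\<And>G. G \<in> \<Gamma> \<Longrightarrow> \<forall>\<sigma>. range \<sigma> \<subseteq> D \<longrightarrow> truth \<sigma> G"
    show "\<forall>\<sigma>. range \<sigma> \<subseteq> D \<longrightarrow> truth \<sigma> F"
    proof (intro allI impI)
      fix \<sigma> :: "nat \<Rightarrow> 'a lst" assume \<sigma>: "range \<sigma> \<subseteq> D"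
      from step show "truth \<sigma> F"
      proof cases
        case m_axiom
        then consider "F \<in> r_basis S \<union> equality_axioms" | "F \<in> prop_axioms" | "F \<in> quantifier_axioms"
          using M by auto
        then show ?thesis
        proof cases
          case 1
          then have "F \<in> Pi_R S L"
            using F M by (intro Pi_R_axiom) (auto intro: basis_rformula equality_axiom_rformula)
          then show ?thesis using \<sigma> truth_Pi_R by blast
        next
          case 2
          then show ?thesis by (rule eval_prop_axiom)
        next
          case 3
          then show ?thesis using \<sigma> by (rule eval_quantifier_axiom)
        qed
      next
        case (m_mp A)
        then show ?thesis using IH[of A] IH[of "Imp A F"] \<sigma> by simp
      next
        case (m_subst A m x)
        then have "range (\<sigma>(x := inst \<sigma> m)) \<subseteq> D" using \<sigma> inst_in_D by auto
        then show ?thesis using m_subst IH by (simp add: eval_subst)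
      next
        case (m_gen A x)
        have "truth (\<sigma>(x := d)) A" if "d \<in> D" for d
        proof -
          have "range (\<sigma>(x := d)) \<subseteq> D" using \<sigma> that by auto
          then show ?thesis using IH m_gen by blast
        qed
        then show ?thesis using m_gen by simp
      next
        case (m_induct p xs G)
        interpret induction_rule S L p xs G \<sigma>
        proof unfold_locales
          \<comment> \<open>Since \<open>M\<close> and \<open>S\<close> have the same predicate
            symbols, substitutivity for every predicate symbol of \<open>G\<close> is available in
            R-derivations.\<close>
          show "is_formula (r_preds S) L G" using m_induct M by simp
          show "(set xs \<union> vars G) \<inter> vars F = {}" if "F \<in> r_basis S" for F
            using m_induct(5) M that by simp
          show "truth \<tau> (replace_pred p xs G F)"
            if "F \<in> r_basis S" "length ls = length xs" "rconclusion F = Pred p ls" "range \<tau> \<subseteq> D"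
            for F ls \<tau>
          proof -
            have "replace_pred p xs G F \<in> \<Gamma>" using m_induct(6) M that by blast
            then show ?thesis using IH that by blast
          qed
        qed (rule \<sigma>)
        show ?thesis using truth_induct m_induct by simp
      qed
    qed
  qed (use Fs in \<open>auto simp: m_proof_def\<close>)
  then show ?thesis using assms(5) by blast
qed

theorem theorem3p6:
  fixes M :: "('a, 'p) math_sys" and S :: "('a, 'p) rec_sys" and L :: "'a lst set"
  assumes "m_rec M = S"
    and "m_alph M = r_alph S" and "m_preds M = r_preds S" and "m_basis M = r_basis S"
    and "mathematical_system M L"
    and "enumerable L"
    and "ground_lists L \<noteq> {}"
  shows "(\<forall>l\<in>ground_lists L. \<forall>m\<in>ground_lists L.
            Eq l m \<in> Pi_M M L \<longleftrightarrow> Eq l m \<in> Pi_R S L) \<and>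
         (\<forall>p\<in>r_preds S. \<forall>ls. set ls \<subseteq> ground_lists L \<longrightarrow>
            (Pred p ls \<in> Pi_M M L \<longleftrightarrow> Pred p ls \<in> Pi_R S L))"
proof -
  interpret ground_structure S L
    using assms(1,5)
    by unfold_locales (auto simp: mathematical_system_def recursive_system_def restricted_lists_def)
  \<comment> \<open>A ground list supplies a constant assignment into \<open>D\<close>. Closed prime
    formulas do not depend on its choice, and their truth is R-derivability.\<close>
  obtain d where "d \<in> D" using assms(7) by auto
  then have "range (\<lambda>_. d) \<subseteq> D" by auto
  then have "F \<in> Pi_R S L" if "F \<in> Pi_M M L" "is_prime F" "free F = {}" for F
    using that truth_Pi_M assms truth_closed_prime by blast
  moreover have "Pi_R S L \<subseteq> Pi_M M L"
    using assms by (intro Pi_R_subset_Pi_M) auto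
  ultimately have "F \<in> Pi_M M L \<longleftrightarrow> F \<in> Pi_R S L" if "is_prime F" "free F = {}" for F
    using that by blast
  moreover have "free (Pred p ls) = {}" if "set ls \<subseteq> D" for p :: 'p and ls
    using that by (auto simp: ground_lists_def)
  ultimately show ?thesis by (simp add: ground_lists_def)
qed

end
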